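(* With parameter $r$, $$\int_0^1 \frac{x^{-\ln x}}{1+x^2}\,dx=\frac r2\int_0^\infty \frac{e^{-r^2 x^2/\pi}}{\cosh (r \sqrt{\pi}\, x)}\,dx.$$
   Context: Here $r$ is a parameter for which no explicit range is specified; the identity generalizes one of Amdeberhan and Moll stated for $r=2$. For $x>0$, $x^{-\ln x}=e^{-(\ln x)^2}$; $\cosh$ is the hyperbolic cosine.
   Formalization: The parameter r is taken to be a positive real: for r < 0 the right side is negative while the left is positive, and for r = 0 the right-hand integral diverges, so the identity fails for every other real r. *)

theory Defs
  imports "HOL-Analysis.Analysis"
begin

end

theory Submission
  imports Defs "HOL-Probability.Probability" "HOL-Complex_Analysis.Complex_Analysis"
begin

text \<open>
  Substituting \<open>x = e\<^sup>t\<close> on the left and rescaling on the right reduces the identity to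
  \<open>\<integral> exp (- t\<^sup>2) / cosh t dt = sqrt \<pi> \<integral> exp (- s\<^sup>2) / cosh (\<pi> s) ds\<close> over the whole line; the
  parameter \<open>r\<close> is only a change of scale. This is Parseval's formula for the Gaussian and the
  hyperbolic secant, both of which are their own Fourier transforms up to scaling. The
  transform of the secant comes from the residue theorem on the rectangle with
  vertices \<open>\<plusminus>R\<close> and \<open>\<plusminus>R + \<i>\<pi>\<close>, which encloses the single pole \<open>\<i>\<pi>/2\<close>: since
  \<open>cosh (z + \<i>\<pi>) = - cosh z\<close>, the top side reproduces the bottom side up to a constant factor.
\<close>

section \<open>The hyperbolic cosine in the complex plane\<close>

lemma cosh_eq_0_in_strip_iff:
  fixes z :: complex
  assumes "- pi / 2 < Im z" "Im z < 3 * pi / 2"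
  shows "cosh z = 0 \<longleftrightarrow> z = \<i> * of_real (pi / 2)"
proof
  assume "cosh z = 0"
  then have "cos (\<i> * z) = 0"
    by (simp add: cosh_conv_cos)
  then obtain n :: int where n: "\<i> * z = of_real (n * pi) + of_real pi / 2"
    by (auto simp: cos_eq_0)
  have Re0: "Re z = 0" and Im: "Im z = - (of_int n * pi + pi / 2)"
    using n by (auto simp: complex_eq_iff)
  \<comment> \<open>The strip bounds amount to \<open>-2 < n < 0\<close>; this form lets the
    positive factor \<open>pi\<close> be cancelled.\<close>
  have "pi * (2 * of_int n) < 0" "pi * (- 4) < pi * (2 * of_int n)"
    using assms Im by (auto simp: algebra_simps)
  then have "2 * real_of_int n < 0" "- 4 < 2 * real_of_int n"
    by (simp_all only: mult_less_cancel_left_pos[OF pi_gt_zero] mult_less_0_iff) auto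
  then have "n = - 1" by simp
  then show "z = \<i> * of_real (pi / 2)"
    using Re0 Im by (simp add: complex_eq_iff)
next
  assume "z = \<i> * of_real (pi / 2)"
  then show "cosh z = 0"
    by (simp only: cosh_field_def exp_minus cis_conv_exp[symmetric] cis_pi_half) simp
qed

text \<open>Reverse triangle inequality for \<open>exp z\<close> and \<open>- exp (- z)\<close>. It
  makes the integrand small on the vertical sides of the rectangle.\<close>

lemma abs_sinh_Re_le_norm_cosh: "\<bar>sinh (Re z)\<bar> \<le> norm (cosh z)"
proof -
  have "\<bar>norm (exp z) - norm (- exp (- z))\<bar> \<le> norm (exp z - - exp (- z))"
    by (rule norm_triangle_ineq3)
  then show ?thesis
    by (simp add: cosh_field_def sinh_field_def norm_divide)
qed

lemma cosh_complex_add_i_pi: "cosh (z + \<i> * of_real pi) = - cosh z"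
  by (simp add: cosh_conv_cos cos_diff distrib_left flip: mult.assoc cos_of_real sin_of_real)

lemma cosh_complex_of_real: "cosh (complex_of_real t) = complex_of_real (cosh t)"
  by (simp add: cosh_field_def flip: exp_of_real)

section \<open>Fourier transform of the hyperbolic secant\<close>

lemma integrable_sech: "integrable lborel (\<lambda>t::real. 1 / cosh t)"
proof (rule Bochner_Integration.integrable_bound)
  show "integrable lborel (\<lambda>t::real. 2 * inverse (1 + t\<^sup>2))"
    using integrable_inverse_1_plus_square by (simp add: set_integrable_def)
  \<comment> \<open>From \<open>\<bar>u\<bar> \<le> \<bar>sinh u\<bar>\<close> at
    \<open>u = t / 2\<close> and the double-angle formula,
    \<open>cosh t \<ge> 1 + t^2 / 2\<close>.\<close>
  have "1 / cosh t \<le> 2 * inverse (1 + t\<^sup>2)" for t :: real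
  proof -
    have "\<bar>t / 2\<bar> \<le> \<bar>sinh (t / 2)\<bar>"
      using real_le_abs_sinh[of "t / 2"] by (simp add: sinh_field_def exp_minus)
    then have "(t / 2)\<^sup>2 \<le> (sinh (t / 2))\<^sup>2"
      using abs_le_square_iff by blast
    moreover have "cosh t = 1 + 2 * (sinh (t / 2))\<^sup>2"
      using cosh_double[of "t / 2"] by (simp add: cosh_square_eq)
    ultimately have "1 + t\<^sup>2 \<le> 2 * cosh t"
      by (simp add: power_divide)
    moreover have "0 < 1 + t\<^sup>2"
      by (simp add: add_pos_nonneg)
    ultimately show ?thesis
      by (simp add: field_simps)
  qed
  then show "AE t in lborel. norm (1 / cosh t) \<le> norm (2 * inverse (1 + t\<^sup>2 :: real))"
    by simp
qed (auto intro!: borel_measurable_continuous_onI continuous_intros)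

text \<open>In the residue theorem the bottom and top sides together give the first term, and the
  pole gives \<open>2 * pi * exp (- pi * \<omega> / 2)\<close>. The error comes from the two
  vertical sides, each of length \<open>pi\<close>.\<close>

lemma fourier_sech_truncated:
  fixes \<omega> R :: real
  assumes "R > 0"
  shows "norm ((1 + exp (- pi * \<omega>)) * integral {- R..R} (\<lambda>t. exp (\<i> * \<omega> * t) / complex_of_real (cosh t))
            - 2 * pi * exp (- pi * \<omega> / 2)) \<le> 2 * pi * (1 + exp (- pi * \<omega>)) / sinh R"
proof -
  define f where "f = (\<lambda>z. exp (\<i> * \<omega> * z) / cosh z)"
  \<comment> \<open>A convex open neighbourhood of the rectangle that stops at the neighbouring
    zeros of \<open>cosh\<close>, so \<open>p\<close> is the only zero inside.\<close>
  define S where "S = {z. - pi / 2 < Im z} \<inter> {z. Im z < 3 * pi / 2}"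
  define p where "p = \<i> * complex_of_real (pi / 2)"
  define a b c d where "a = complex_of_real (- R)" and "b = complex_of_real R"
    and "c = R + \<i> * pi" and "d = - R + \<i> * pi"
  have S: "open S" "convex S"
    unfolding S_def by (intro open_Int open_halfspace_Im_gt open_halfspace_Im_lt
      convex_Int convex_halfspace_Im_gt convex_halfspace_Im_lt)+
  have pS: "p \<in> S"
    using pi_gt_zero by (simp add: p_def S_def del: pi_gt_zero)
  have cosh0: "cosh z = 0 \<longleftrightarrow> z = p" if "z \<in> S" for z
    using that cosh_eq_0_in_strip_iff[of z] by (simp add: S_def p_def)
  have sinh_p: "sinh p = \<i>"
    by (simp only: p_def sinh_field_def exp_minus cis_conv_exp[symmetric] cis_pi_half) simp
  have cosh_holo: "cosh holomorphic_on A" for A :: "complex set"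
    unfolding cosh_field_def[abs_def] by (intro holomorphic_intros) simp
  have holo: "f holomorphic_on S - {p}"
    unfolding f_def using cosh0 by (auto intro!: holomorphic_intros cosh_holo)
  \<comment> \<open>The pole is simple because the derivative of \<open>cosh\<close> at
    \<open>p\<close> is \<open>sinh p = \<i>\<close>, which is nonzero.\<close>
  have res: "residue f p = exp (\<i> * \<omega> * p) / \<i>"
    unfolding f_def
  proof (rule residue_simple_pole_deriv[where s = S])
    show "(cosh has_field_derivative \<i>) (at p)"
      using sinh_p by (auto intro!: derivative_eq_intros)
  qed (use S pS cosh0 in \<open>auto intro!: holomorphic_intros cosh_holo convex_connected\<close>)
  have corners: "Complex (Re c) (Im a) = b" "Complex (Re a) (Im c) = d"
    by (auto simp: a_def b_def c_def d_def complex_eq_iff)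
  have rect: "rectpath a c = linepath a b +++ linepath b c +++ linepath c d +++ linepath d a"
    by (simp add: rectpath_def corners)
  have ac: "Re a = - R" "Im a = 0" "Re c = R" "Im c = pi"
    by (simp_all add: a_def c_def)
  have cbox_S: "cbox a c \<subseteq> S"
    using pi_gt_zero by (auto simp: S_def in_cbox_complex_iff ac simp del: pi_gt_zero)
  have p_box: "p \<in> box a c"
    using assms by (auto simp: p_def in_box_complex_iff ac)
  have img: "path_image (rectpath a c) \<subseteq> S - {p}"
    using cbox_S p_box assms by (auto simp: path_image_rectpath_cbox_minus_box ac)
  have *: "contour_integral (rectpath a c) f
      = 2 * pi * \<i> * (\<Sum>p\<in>{p}. winding_number (rectpath a c) p * residue f p)"
    using S holo img cbox_S assms
    by (intro Residue_theorem[where S = S] allI impI winding_number_rectpath_outside)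
       (auto simp: convex_connected ac)
  have total: "contour_integral (rectpath a c) f = 2 * pi * exp (- pi * \<omega> / 2)"
  proof -
    have "\<i> * \<omega> * p = complex_of_real (- pi * \<omega> / 2)"
      by (simp add: p_def complex_eq_iff)
    then have "residue f p = complex_of_real (exp (- pi * \<omega> / 2)) / \<i>"
      by (simp only: res exp_of_real)
    moreover have "contour_integral (rectpath a c) f = 2 * pi * \<i> * residue f p"
      using * winding_number_rectpath[OF p_box] by simp
    moreover have "2 * pi * \<i> * (w / \<i>) = 2 * pi * w" for w
      by simp
    ultimately show ?thesis
      by (simp only: of_real_mult)
  qed
  have imgs: "closed_segment a b \<subseteq> S - {p}" "closed_segment b c \<subseteq> S - {p}"
      "closed_segment c d \<subseteq> S - {p}" "closed_segment d a \<subseteq> S - {p}"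
    using img unfolding rect by (auto simp: path_image_join)
  have cont: "continuous_on (S - {p}) f"
    using holo by (rule holomorphic_on_imp_continuous_on)
  have ints: "f contour_integrable_on linepath a b" "f contour_integrable_on linepath b c"
      "f contour_integrable_on linepath c d" "f contour_integrable_on linepath d a"
    using imgs by (auto intro!: contour_integrable_continuous_linepath continuous_on_subset[OF cont])
  define I where "I = contour_integral (linepath a b) f"
  define V where "V = contour_integral (linepath b c) f"
  define W where "W = contour_integral (linepath d a) f"
  have I: "I = integral {- R..R} (\<lambda>t. f (of_real t))"
    using ints(1) assms has_contour_integral_linepath_Reals_iff[of a b f I]
    by (auto simp: I_def a_def b_def has_contour_integral_integral intro!: integral_unique[symmetric])
  have shift: "f (z + \<i> * pi) = - exp (- pi * \<omega>) * f z" for z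
  proof -
    have "\<i> * \<omega> * (z + \<i> * pi) = \<i> * \<omega> * z + complex_of_real (- pi * \<omega>)"
      by (simp add: complex_eq_iff algebra_simps)
    then have "exp (\<i> * \<omega> * (z + \<i> * pi)) = exp (\<i> * \<omega> * z) * complex_of_real (exp (- pi * \<omega>))"
      by (simp only: exp_add exp_of_real)
    then show ?thesis
      by (simp add: f_def cosh_complex_add_i_pi)
  qed
  \<comment> \<open>The reversed orientation and the sign change of \<open>cosh\<close> cancel, so
    the top side adds to the bottom side.\<close>
  have "contour_integral (linepath c d) f = - contour_integral (linepath d c) f"
    using contour_integral_reversepath[of "linepath d c" f] by simp
  also have "contour_integral (linepath d c) f
      = contour_integral (linepath a b) (\<lambda>z. f (z + \<i> * pi))"
  proof -
    have "linepath d c x = linepath a b x + \<i> * pi" for x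
      by (simp add: linepath_def a_def b_def c_def d_def scaleR_conv_of_real algebra_simps)
    then show ?thesis
      by (simp add: contour_integral_integral) (simp add: a_def b_def c_def d_def)
  qed
  also have "\<dots> = - exp (- pi * \<omega>) * I"
    unfolding shift I_def using ints(1) contour_integral_lmul by blast
  finally have top: "contour_integral (linepath c d) f = exp (- pi * \<omega>) * I"
    by simp
  have "contour_integral (rectpath a c) f = I + (V + (exp (- pi * \<omega>) * I + W))"
    unfolding rect using ints by (simp add: I_def V_def W_def top)
  then have eq: "(1 + exp (- pi * \<omega>)) * I - 2 * pi * exp (- pi * \<omega> / 2) = - (V + W)"
    using total by (simp add: algebra_simps)
  define B where "B = (1 + exp (- pi * \<omega>)) / sinh R"
  have B0: "B \<ge> 0"
    using assms by (auto simp: B_def intro!: divide_nonneg_pos add_nonneg_nonneg)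
  have side: "norm (f z) \<le> B" if "\<bar>Re z\<bar> = R" "0 \<le> Im z" "Im z \<le> pi" for z
  proof -
    have "norm (exp (\<i> * \<omega> * z)) = exp (- (\<omega> * Im z))"
      by simp
    \<comment> \<open>The exponent lies between \<open>0\<close> and \<open>- pi * \<omega>\<close>;
      the sum dominates both extremes, whatever the sign of \<open>\<omega>\<close>.\<close>
    also have "\<dots> \<le> 1 + exp (- pi * \<omega>)"
    proof (cases "\<omega> \<ge> 0")
      case True
      then have "exp (- (\<omega> * Im z)) \<le> 1"
        using that by simp
      then show ?thesis by (simp add: add_increasing2)
    next
      case False
      then have "exp (- (\<omega> * Im z)) \<le> exp (- pi * \<omega>)"
        using that by (simp add: mult.commute)
      then show ?thesis by linarith
    qed
    finally have "norm (exp (\<i> * \<omega> * z)) \<le> 1 + exp (- pi * \<omega>)" .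
    moreover have "sinh R \<le> norm (cosh z)"
      using abs_sinh_Re_le_norm_cosh[of z] that sinh_real_abs[of "Re z"] by simp
    ultimately show ?thesis
      unfolding f_def B_def norm_divide using assms
      by (intro frac_le) (auto simp: add_nonneg_nonneg)
  qed
  have "norm V \<le> B * norm (c - b)"
    unfolding V_def using ints(2) B0
  proof (rule contour_integral_bound_linepath)
    fix z assume "z \<in> closed_segment b c"
    then have "\<bar>Re z\<bar> = R \<and> 0 \<le> Im z \<and> Im z \<le> pi"
      using assms closed_segment_same_Re[of b c]
      by (auto simp: b_def c_def closed_segment_eq_real_ivl)
    then show "norm (f z) \<le> B" using side by blast
  qed
  moreover have "norm W \<le> B * norm (a - d)"
    unfolding W_def using ints(4) B0
  proof (rule contour_integral_bound_linepath)
    fix z assume "z \<in> closed_segment d a"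
    then have "\<bar>Re z\<bar> = R \<and> 0 \<le> Im z \<and> Im z \<le> pi"
      using assms closed_segment_same_Re[of d a]
      by (auto simp: a_def d_def closed_segment_eq_real_ivl split: if_splits)
    then show "norm (f z) \<le> B" using side by blast
  qed
  ultimately have "norm V + norm W \<le> 2 * pi * B"
    by (simp add: a_def b_def c_def d_def norm_mult mult.commute)
  then have "norm ((1 + exp (- pi * \<omega>)) * I - 2 * pi * exp (- pi * \<omega> / 2)) \<le> 2 * pi * B"
    unfolding eq norm_minus_cancel using norm_triangle_ineq[of V W] by linarith
  then show ?thesis
    by (simp add: I f_def B_def cosh_complex_of_real)
qed

lemma integrable_divide_cosh:
  fixes g :: "real \<Rightarrow> complex"
  assumes "g \<in> borel_measurable borel" "\<And>t. norm (g t) \<le> 1"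
  shows "integrable lborel (\<lambda>t. g t / complex_of_real (cosh t))"
proof (rule Bochner_Integration.integrable_bound[OF integrable_sech])
  show "(\<lambda>t. g t / complex_of_real (cosh t)) \<in> borel_measurable lborel"
    using assms(1) unfolding cosh_field_def by measurable
  show "AE t in lborel. norm (g t / complex_of_real (cosh t)) \<le> norm (1 / cosh t)"
    using assms(2) by (auto simp: norm_divide divide_right_mono)
qed

text \<open>Let \<open>R\<close> tend to infinity in the truncated estimate: dominated convergence
  handles the integral, and the error vanishes since \<open>sinh R\<close> is unbounded.\<close>

lemma fourier_sech:
  fixes \<omega> :: real
  shows "(CLBINT t. exp (\<i> * \<omega> * t) / complex_of_real (cosh t)) = pi / cosh (pi * \<omega> / 2)"
proof -
  define f where "f = (\<lambda>t::real. exp (\<i> * \<omega> * t) / complex_of_real (cosh t))"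
  define E where "E = 1 + exp (- pi * \<omega>)"
  have "E > 0" by (simp add: E_def add_pos_pos)
  have int: "integrable lborel f"
    unfolding f_def by (rule integrable_divide_cosh) auto
  have si: "set_integrable lborel {- R..R} f" for R
    using int by (rule integrable_mult_indicator[rotated, folded set_integrable_def]) simp
  have "((\<lambda>R. CLBINT t:{- R..R}. f t) \<longlongrightarrow> (CLBINT t. f t)) at_top"
    unfolding set_lebesgue_integral_def
  proof (rule integral_dominated_convergence_at_top[where w = "\<lambda>t. norm (f t)"])
    show "AE t in lborel. ((\<lambda>R. indicator {- R..R} t *\<^sub>R f t) \<longlongrightarrow> f t) at_top"
    proof (intro AE_I2 tendsto_eventually)
      fix t :: real
      show "eventually (\<lambda>R. indicator {- R..R} t *\<^sub>R f t = f t) at_top"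
        using eventually_ge_at_top[of "\<bar>t\<bar>"] by eventually_elim (auto simp: indicator_def)
    qed
  qed (use int in \<open>auto simp: indicator_def\<close>)
  \<comment> \<open>The contour estimate is phrased with the gauge integral, hence the change of
    integral here.\<close>
  then have "((\<lambda>R. integral {- R..R} f) \<longlongrightarrow> (CLBINT t. f t)) at_top"
    using set_borel_integral_eq_integral(2)[OF si] by simp
  then have "((\<lambda>R. E * integral {- R..R} f - 2 * pi * exp (- pi * \<omega> / 2)) \<longlongrightarrow>
      E * (CLBINT t. f t) - 2 * pi * exp (- pi * \<omega> / 2)) at_top"
    by (intro tendsto_intros)
  moreover have "((\<lambda>R. E * integral {- R..R} f - 2 * pi * exp (- pi * \<omega> / 2)) \<longlongrightarrow> 0) at_top"
  proof (rule Lim_null_comparison)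
    show "eventually (\<lambda>R. norm (E * integral {- R..R} f - 2 * pi * exp (- pi * \<omega> / 2))
        \<le> 2 * pi * E / sinh R) at_top"
      using eventually_gt_at_top[of 0]
      by eventually_elim (use fourier_sech_truncated in \<open>simp add: E_def f_def\<close>)
    show "((\<lambda>R. 2 * pi * E / sinh R) \<longlongrightarrow> 0) at_top"
      by (rule real_tendsto_divide_at_top[OF tendsto_const sinh_real_at_top])
  qed
  ultimately have "E * (CLBINT t. f t) - 2 * pi * exp (- pi * \<omega> / 2) = 0"
    by (intro tendsto_unique[OF trivial_limit_at_top_linorder])
  then have "(CLBINT t. f t) = complex_of_real (2 * pi * exp (- pi * \<omega> / 2) / E)"
    using \<open>E > 0\<close> by (simp add: field_simps)
  also have "2 * pi * exp (- pi * \<omega> / 2) / E = pi / cosh (pi * \<omega> / 2)"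
  proof -
    \<comment> \<open>Extracting the geometric mean of the two summands of \<open>E\<close> leaves a
      symmetric sum, which is twice a hyperbolic cosine.\<close>
    have "E = exp (- pi * \<omega> / 2) * (2 * cosh (pi * \<omega> / 2))"
      by (simp add: E_def cosh_field_def distrib_left add_divide_distrib flip: exp_add)
    then show ?thesis by simp
  qed
  finally show ?thesis
    by (simp add: f_def)
qed

section \<open>Fourier transform of the Gaussian and Parseval's formula\<close>

lemma integrable_gaussian: "integrable lborel (\<lambda>s::real. exp (- s\<^sup>2))"
  using has_bochner_integral_even_function[OF gaussian_moment_0] by (auto simp: integrable.simps)

text \<open>This is the characteristic function of the standard normal distribution at
  \<open>sqrt 2 * t\<close>, after the substitution \<open>x = sqrt 2 * s\<close>. The frequency
  \<open>2 * s\<close> turns the secant's transform into \<open>pi / cosh (pi * s)\<close>.\<close>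

lemma fourier_gaussian:
  fixes t :: real
  shows "(CLBINT s. exp (\<i> * (2 * s) * t) * complex_of_real (exp (- s\<^sup>2))) = sqrt pi * exp (- t\<^sup>2)"
proof -
  have "exp (- t\<^sup>2) = char std_normal_distribution (sqrt 2 * t)"
    by (simp add: char_std_normal_distribution power_mult_distrib)
  also have "\<dots> = (CLBINT x. std_normal_density x *\<^sub>R iexp (sqrt 2 * t * x))"
    unfolding char_def by (subst integral_density) auto
  also have "\<dots> = sqrt 2 *\<^sub>R (CLBINT s. std_normal_density (sqrt 2 * s) *\<^sub>R iexp (sqrt 2 * t * (sqrt 2 * s)))"
    by (subst lborel_integral_real_affine[where c = "sqrt 2" and t = 0]) auto
  also have "\<dots> = sqrt 2 *\<^sub>R (CLBINT s. (1 / sqrt (2 * pi)) *\<^sub>R (exp (\<i> * (2 * s) * t) * complex_of_real (exp (- s\<^sup>2))))"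
  proof -
    have "sqrt 2 * t * (sqrt 2 * s) = 2 * s * t" for s
      by (simp add: algebra_simps)
    then show ?thesis
      by (simp add: std_normal_density_def power_mult_distrib scaleR_conv_of_real mult_ac)
  qed
  also have "\<dots> = (1 / sqrt pi) *\<^sub>R (CLBINT s. exp (\<i> * (2 * s) * t) * complex_of_real (exp (- s\<^sup>2)))"
    by (simp add: real_sqrt_mult)
  finally show ?thesis
    by (simp add: scaleR_conv_of_real field_simps)
qed

text \<open>Fubini for the kernel \<open>F\<close>: integrating over \<open>s\<close> first
  transforms the Gaussian, integrating over \<open>t\<close> first transforms the secant.\<close>

lemma gaussian_sech_duality:
  "(LBINT t. exp (- t\<^sup>2) / cosh t) = sqrt pi * (LBINT s. exp (- s\<^sup>2) / cosh (pi * s))"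
proof -
  define F :: "real \<Rightarrow> real \<Rightarrow> complex"
    where "F = (\<lambda>s t. exp (\<i> * (2 * s) * t) * complex_of_real (exp (- s\<^sup>2)) / complex_of_real (cosh t))"
  \<comment> \<open>The modulus separates the variables, so absolute integrability of
    \<open>F\<close> reduces to that of the two factors.\<close>
  have normF: "norm (F s t) = exp (- s\<^sup>2) * (1 / cosh t)" for s t
    by (simp add: F_def norm_mult norm_divide)
  have "integrable (lborel \<Otimes>\<^sub>M lborel) (\<lambda>(s, t). F s t)"
  proof (rule lborel_pair.Fubini_integrable)
    show "(\<lambda>(s, t). F s t) \<in> borel_measurable (lborel \<Otimes>\<^sub>M lborel)"
      unfolding F_def cosh_field_def by measurable
    show "integrable lborel (\<lambda>s. LBINT t. norm (case (s, t) of (s, t) \<Rightarrow> F s t))"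
      by (simp add: normF integrable_gaussian del: times_divide_eq_right)
    show "AE s in lborel. integrable lborel (\<lambda>t. case (s, t) of (s, t) \<Rightarrow> F s t)"
      using integrable_divide_cosh[of "\<lambda>t. exp (\<i> * (2 * s) * t) * complex_of_real (exp (- s\<^sup>2))" for s]
      by (simp add: F_def norm_mult)
  qed
  then have "(CLBINT t. CLBINT s. F s t) = (CLBINT s. CLBINT t. F s t)"
    by (rule lborel_pair.Fubini_integral)
  moreover have "(CLBINT s. F s t) = complex_of_real (sqrt pi * (exp (- t\<^sup>2) / cosh t))" for t
    using fourier_gaussian[of t] by (simp add: F_def)
  moreover have "(CLBINT t. F s t) = complex_of_real (pi * (exp (- s\<^sup>2) / cosh (pi * s)))" for s
  proof -
    have "(CLBINT t. F s t) = exp (- s\<^sup>2) * (CLBINT t. exp (\<i> * (2 * s) * t) / complex_of_real (cosh t))"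
      unfolding integral_mult_right_zero[symmetric] by (simp add: F_def mult_ac)
    then show ?thesis
      using fourier_sech[of "2 * s"] by simp
  qed
  ultimately have "sqrt pi * (LBINT t. exp (- t\<^sup>2) / cosh t) = pi * (LBINT s. exp (- s\<^sup>2) / cosh (pi * s))"
    by (simp only: integral_complex_of_real of_real_eq_iff integral_mult_right_zero)
  then have "sqrt pi * (LBINT t. exp (- t\<^sup>2) / cosh t)
      = sqrt pi * (sqrt pi * (LBINT s. exp (- s\<^sup>2) / cosh (pi * s)))"
    by (simp flip: mult.assoc)
  then show ?thesis by simp
qed

section \<open>Half-line integrals and changes of variable\<close>

lemma integrable_gaussian_sech: "integrable lborel (\<lambda>s::real. exp (- s\<^sup>2) / cosh (c * s))"
proof (rule Bochner_Integration.integrable_bound[OF integrable_gaussian])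
  show "(\<lambda>s. exp (- s\<^sup>2) / cosh (c * s)) \<in> borel_measurable lborel"
    unfolding cosh_field_def by measurable
  show "AE s in lborel. norm (exp (- s\<^sup>2) / cosh (c * s)) \<le> norm (exp (- s\<^sup>2))"
    using cosh_real_ge_1 by (auto simp: field_simps)
qed

lemma LBINT_half_line_even:
  fixes f :: "real \<Rightarrow> real"
  assumes "integrable lborel f" "\<And>x. f (- x) = f x"
  shows "(LBINT x=0..\<infinity>. f x) = (LBINT x. f x) / 2"
proof -
  have si: "integrable lborel (\<lambda>x. indicator {0..} x *\<^sub>R f x)"
    using assms(1) by (intro integrable_mult_indicator) auto
  have "(LBINT x. f x) = 2 * (LBINT x. indicator {0..} x *\<^sub>R f x)"
    using has_bochner_integral_even_function[OF has_bochner_integral_integrable[OF si]] assms(2)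
    by (auto dest: has_bochner_integral_integral_eq)
  \<comment> \<open>Interval integrals run over the open half-line; the point \<open>0\<close> is a
    null set.\<close>
  also have "(LBINT x. indicator {0..} x *\<^sub>R f x) = (LBINT x. indicator {0<..} x *\<^sub>R f x)"
    by (rule integral_discrete_difference[where X = "{0}"]) (auto simp: indicator_def)
  finally show ?thesis
    by (simp add: interval_lebesgue_integral_0_infty set_lebesgue_integral_def)
qed

text \<open>The integrability conjuncts ensure that neither integral is the default value
  \<open>0\<close>. The sign of \<open>r\<close> matters: the right side is odd in \<open>r\<close>,
  while the left side does not depend on it.\<close>

theorem mainTheorem15:
  fixes r :: real
  assumes "r > 0"
  shows "interval_lebesgue_integrable lborel 0 1 (\<lambda>x::real. x powr (- ln x) / (1 + x\<^sup>2))
    \<and> interval_lebesgue_integrable lborel 0 \<infinity> (\<lambda>x::real. exp (- (r\<^sup>2 * x\<^sup>2) / pi) / cosh (r * sqrt pi * x))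
    \<and> (LBINT x=0..1. x powr (- ln x) / (1 + x\<^sup>2))
      = r / 2 * (LBINT x=0..\<infinity>. exp (- (r\<^sup>2 * x\<^sup>2) / pi) / cosh (r * sqrt pi * x))"
proof -
  define f where "f = (\<lambda>x::real. x powr (- ln x) / (1 + x\<^sup>2))"
  define h where "h = (\<lambda>x::real. exp (- (r\<^sup>2 * x\<^sup>2) / pi) / cosh (r * sqrt pi * x))"
  define g where "g = (\<lambda>t::real. exp (- t\<^sup>2) / cosh t)"
  define k where "k = (\<lambda>s::real. exp (- s\<^sup>2) / cosh (pi * s))"
  have g: "integrable lborel g" and k: "integrable lborel k"
    using integrable_gaussian_sech[of 1] integrable_gaussian_sech[of pi] by (simp_all add: g_def k_def)
  have g_even: "g (- t) = g t" for t
    by (simp add: g_def)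
  \<comment> \<open>The factor \<open>exp t\<close> in
    \<open>1 + (exp t)^2 = 2 * exp t * cosh t\<close> cancels the derivative of the
    substitution.\<close>
  have pull: "f (exp t) * exp t = g t / 2" for t
  proof -
    have "1 + (exp t)\<^sup>2 = 2 * exp t * cosh t"
      by (simp add: cosh_field_def exp_minus power2_eq_square field_simps)
    then show ?thesis
      by (simp add: f_def g_def powr_def power2_eq_square)
  qed
  have g_set: "set_integrable lborel (einterval (-\<infinity>) 0) (\<lambda>t. f (exp t) * exp t)"
    unfolding pull set_integrable_def using g by (intro integrable_mult_indicator) auto
  have lim0: "((ereal \<circ> exp \<circ> real_of_ereal) \<longlongrightarrow> 0) (at_right (- \<infinity>))"
    by (auto simp: ereal_tendsto_simps zero_ereal_def exp_at_bot)
  have lim1: "((ereal \<circ> exp \<circ> real_of_ereal) \<longlongrightarrow> 1) (at_left 0)"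
    unfolding zero_ereal_def one_ereal_def by (auto simp: ereal_tendsto_simps intro!: tendsto_eq_intros)
  \<comment> \<open>For nonnegative integrands, substitution yields integrability on the image
    interval as well as the value of the integral.\<close>
  note subst = interval_integral_substitution_nonneg[of "-\<infinity>" 0 exp exp f, OF _ _ _ _ _ _ lim0 lim1 g_set]
  have f_int: "set_integrable lborel (einterval 0 1) f"
    by (rule subst(1)) (auto simp: f_def add_nonneg_eq_0_iff intro!: derivative_eq_intros continuous_intros)
  have "(LBINT x=0..1. f x) = (LBINT t=-\<infinity>..0. f (exp t) * exp t)"
    by (rule subst(2)) (auto simp: f_def add_nonneg_eq_0_iff intro!: derivative_eq_intros continuous_intros)
  also have "\<dots> = (LBINT t=0..\<infinity>. g t) / 2"
    unfolding pull by (subst interval_integral_reflect) (simp add: g_even)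
  \<comment> \<open>One half comes from \<open>pull\<close>, the other from evenness.\<close>
  also have "\<dots> = (LBINT t. g t) / 4"
    by (simp add: LBINT_half_line_even[OF g g_even])
  also have "\<dots> = sqrt pi * (LBINT s. k s) / 4"
    using gaussian_sech_duality by (simp add: g_def k_def)
  finally have lhs: "(LBINT x=0..1. f x) = sqrt pi * (LBINT s. k s) / 4" .
  \<comment> \<open>This scale matches both factors: \<open>c^2 = r^2 / pi\<close> in the exponent
    and \<open>pi * c = r * sqrt pi\<close> inside \<open>cosh\<close>.\<close>
  define c where "c = r / sqrt pi"
  have "c > 0" using assms by (simp add: c_def)
  have h_eq: "h x = k (c * x)" for x
  proof -
    have "pi * c = r * sqrt pi"
      using real_div_sqrt[of pi] by (simp add: c_def field_simps)
    then have "cosh (pi * (c * x)) = cosh (r * sqrt pi * x)"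
      by (simp only: mult.assoc[symmetric])
    then show ?thesis
      by (simp add: h_def k_def c_def power_mult_distrib power_divide)
  qed
  have h: "integrable lborel h"
    using lborel_integrable_real_affine[OF k, of c 0] \<open>c > 0\<close> by (simp add: h_eq[abs_def])
  have "(LBINT x. h x) = 2 * (LBINT x=0..\<infinity>. h x)"
    using LBINT_half_line_even[OF h] by (simp add: h_def)
  moreover have "(LBINT s. k s) = c * (LBINT x. h x)"
    using \<open>c > 0\<close> by (subst lborel_integral_real_affine[of c _ 0]) (simp_all flip: h_eq)
  \<comment> \<open>The constants combine as \<open>sqrt pi * c * 2 / 4 = r / 2\<close>.\<close>
  ultimately have "(LBINT x=0..1. f x) = r / 2 * (LBINT x=0..\<infinity>. h x)"
    using lhs by (simp add: c_def)
  moreover have "interval_lebesgue_integrable lborel 0 1 f"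
    using f_int by (simp add: interval_lebesgue_integrable_def)
  moreover have "interval_lebesgue_integrable lborel 0 \<infinity> h"
    using h unfolding interval_lebesgue_integral_0_infty set_integrable_def
    by (intro integrable_mult_indicator) auto
  ultimately show ?thesis
    by (simp add: f_def h_def)
qed

end
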